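(* Let $n>1$ be an integer and let $a,b\in\mathbb Z_n$ be incomparable with respect to $\leq$. Let $d=\gcd(\gcd(a,b),n)$. Then the join $a\vee b$ (least upper bound of $\{a,b\}$) exists in $(\mathbb Z_n,\leq)$ if and only if the coset $(n/d)+1=\{x(n/d)+1: x\in\mathbb Z_n\}$ has a smallest element with respect to $\leq$.
   Context: On $\mathbb Z_n$ define the partial order $\leq$ by: $a\leq b$ iff $a=b$ or $a\equiv ab\pmod n$. For $x\in\mathbb Z_n$, $(x)$ denotes the ideal of $\mathbb Z_n$ generated by $x$. Gcds are taken of integer representatives (the value is independent of the choice). *)

theory Defs
  imports "HOL-Number_Theory.Residues"
begin

text \<open>
  \<open>\<int>\<^sub>n\<close> is \<open>residue_ring n\<close>, whose elements are the representatives
  \<open>0, \<dots>, n - 1\<close>.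
\<close>

definition zn_order :: "int \<Rightarrow> int gorder" where
  "zn_order n = \<lparr>carrier = carrier (residue_ring n), eq = (=),
                 le = (\<lambda>a b. a = b \<or> [a = a * b] (mod n))\<rparr>"

definition has_join :: "('a, 'b) gorder_scheme \<Rightarrow> 'a \<Rightarrow> 'a \<Rightarrow> bool" where
  "has_join L a b \<longleftrightarrow> (\<exists>s. least L s (Upper L {a, b}))"

text \<open>
  The coset \<open>(c) + 1\<close> in \<open>\<int>\<^sub>n\<close>, for an integer \<open>c\<close>. Reducing \<open>c\<close> modulo \<open>n\<close> gives
  the element of \<open>\<int>\<^sub>n\<close> it stands for; this matters when \<open>c = n\<close>.
\<close>

definition zn_coset_one :: "int \<Rightarrow> int \<Rightarrow> int set" where
  "zn_coset_one n c = (let R = residue_ring n in (PIdl\<^bsub>R\<^esub> (c mod n)) +>\<^bsub>R\<^esub> \<one>\<^bsub>R\<^esub>)"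

lemma partial_order_zn_order:
  assumes "n > 1"
  shows "partial_order (zn_order n)"
proof -
  have eqI: "x = y" if "[x = y] (mod n)" "x \<in> {0..n-1}" "y \<in> {0..n-1}" for x y :: int
    using that by (auto simp: cong_def)
  have tr: "[x = x * z] (mod n)" if "[x = x * y] (mod n)" "[y = y * z] (mod n)" for x y z :: int
  proof -
    have "[x * z = x * y * z] (mod n)" using that(1) by (rule cong_scalar_right)
    also have "[x * y * z = x * y] (mod n)"
      using cong_scalar_left[OF cong_sym[OF that(2)], of x] by (simp add: mult.assoc)
    also have "[x * y = x] (mod n)" using that(1) by (rule cong_sym)
    finally show ?thesis by (rule cong_sym)
  qed
  have antisym: "x = y" if "[x = x * y] (mod n)" "[y = y * x] (mod n)"
      "x \<in> {0..n-1}" "y \<in> {0..n-1}" for x y :: int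
  proof (rule eqI)
    show "[x = y] (mod n)"
      using that(1,2) by (metis cong_sym cong_trans mult.commute)
  qed (use that in auto)
  show ?thesis
  proof
    fix x y z
    assume "x \<sqsubseteq>\<^bsub>zn_order n\<^esub> y" "y \<sqsubseteq>\<^bsub>zn_order n\<^esub> z"
    then show "x \<sqsubseteq>\<^bsub>zn_order n\<^esub> z"
      using tr by (auto simp: zn_order_def)
  qed (use antisym in \<open>auto simp: zn_order_def residue_ring_def\<close>)
qed

lemma zn_coset_one_eq:
  assumes "n > 1"
  shows "zn_coset_one n c = {(x * c + 1) mod n | x. x \<in> {0..n-1}}"
  using assms unfolding zn_coset_one_def Let_def a_r_coset_def r_coset_def cgenideal_def
  by (auto simp: residue_ring_def mod_simps)

end

theory Submission
  imports Defs
begin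

text \<open>
  For incomparable \<open>a\<close> and \<open>b\<close> no upper bound equals \<open>a\<close> or \<open>b\<close>, so the upper bounds are the \<open>u\<close>
  with \<open>n\<close> dividing both \<open>a (u - 1)\<close> and \<open>b (u - 1)\<close>, that is, with \<open>n / d\<close> dividing \<open>u - 1\<close>.
  Hence the set of upper bounds is the coset itself, and the two least elements coincide.
\<close>

text \<open>The left side says that \<open>n\<close> divides \<open>gcd a b * x\<close>, up to sign
  the gcd of \<open>a * x\<close> and \<open>b * x\<close>. Cancelling \<open>?d\<close> leaves
  \<open>n div ?d\<close>, which is coprime to the remaining factor
  \<open>gcd a b div ?d\<close>.\<close>

lemma dvd_gcd_mult_iff:
  fixes a b n x :: int
  assumes "n \<noteq> 0"
  shows "n dvd a * x \<and> n dvd b * x \<longleftrightarrow> n div gcd (gcd a b) n dvd x"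
proof -
  let ?d = "gcd (gcd a b) n"
  have d: "?d \<noteq> 0" using assms by simp
  have "n dvd a * x \<and> n dvd b * x \<longleftrightarrow> n dvd gcd (a * x) (b * x)"
    by simp
  also have "\<dots> \<longleftrightarrow> n dvd gcd a b * x"
    by (simp add: gcd_mult_right gcd.commute)
  \<comment> \<open>Both sides are written as multiples of \<open>?d\<close>, so that the nonzero
    factor can be cancelled.\<close>
  also have "\<dots> \<longleftrightarrow> (n div ?d) * ?d dvd (gcd a b div ?d * x) * ?d"
  proof -
    have "gcd a b div ?d * x * ?d = gcd a b div ?d * ?d * x"
      by (simp only: mult_ac)
    also have "\<dots> = gcd a b * x"
      by (simp only: dvd_div_mult_self gcd_dvd1)
    finally show ?thesis
      by (simp only: dvd_div_mult_self gcd_dvd2)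
  qed
  also have "\<dots> \<longleftrightarrow> n div ?d dvd gcd a b div ?d * x"
    by (simp only: dvd_mult_cancel_right d simp_thms)
  also have "\<dots> \<longleftrightarrow> n div ?d dvd x"
    using div_gcd_coprime[of "gcd a b" n] assms
    by (intro coprime_dvd_mult_right_iff) (auto simp: coprime_commute)
  finally show ?thesis .
qed

text \<open>Since \<open>c\<close> divides \<open>n\<close>, reduction modulo \<open>n\<close>
  preserves residues modulo \<open>c\<close>, so coset elements remain 1 modulo
  \<open>c\<close>.\<close>

lemma mem_zn_coset_one_iff:
  assumes "n > 1" and "c dvd n"
  shows "u \<in> zn_coset_one n c \<longleftrightarrow> u \<in> {0..n-1} \<and> c dvd u - 1"
proof
  assume "u \<in> zn_coset_one n c"
  then obtain x where u: "u = (x * c + 1) mod n"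
    using zn_coset_one_eq[OF assms(1)] by auto
  have "[u = x * c + 1] (mod c)"
    unfolding u using assms(2) by (simp add: cong_def mod_mod_cancel)
  then have "[u = 1] (mod c)"
    by (simp add: cong_def)
  then show "u \<in> {0..n-1} \<and> c dvd u - 1"
    using assms(1) u by (auto simp: cong_iff_dvd_diff)
next
  assume u: "u \<in> {0..n-1} \<and> c dvd u - 1"
  then obtain k where k: "u - 1 = c * k" by auto
  \<comment> \<open>The quotient \<open>k\<close> may lie outside \<open>{0..n-1}\<close>. Its
    residue modulo \<open>n\<close> is an admissible coefficient and gives the same element.\<close>
  have "u = (k mod n * c + 1) mod n"
  proof -
    have "(k mod n * c + 1) mod n = (c * k + 1) mod n"
      by (metis mod_add_left_eq mod_mult_left_eq mult.commute)
    also have "\<dots> = u mod n"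
      by (simp flip: k)
    finally show ?thesis using u by simp
  qed
  moreover have "k mod n \<in> {0..n-1}" using assms(1) by simp
  ultimately show "u \<in> zn_coset_one n c"
    using zn_coset_one_eq[OF assms(1)] by blast
qed

lemma Upper_zn_order_incomparable:
  fixes n a b :: int
  assumes "n > 1"
    and "a \<in> carrier (zn_order n)" and "b \<in> carrier (zn_order n)"
    and "\<not> a \<sqsubseteq>\<^bsub>zn_order n\<^esub> b" and "\<not> b \<sqsubseteq>\<^bsub>zn_order n\<^esub> a"
  shows "Upper (zn_order n) {a, b} = zn_coset_one n (n div gcd (gcd a b) n)"
proof -
  let ?c = "n div gcd (gcd a b) n"
  have carr: "carrier (zn_order n) = {0..n-1}"
    by (simp add: zn_order_def residue_ring_def)
  have le: "x \<sqsubseteq>\<^bsub>zn_order n\<^esub> u \<longleftrightarrow> x = u \<or> n dvd x * (u - 1)" for x u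
  proof -
    have "[x = x * u] (mod n) \<longleftrightarrow> n dvd x * (u - 1)"
      by (simp add: cong_iff_dvd_diff dvd_diff_commute[of n x] right_diff_distrib)
    then show ?thesis by (simp add: zn_order_def)
  qed
  have "?c dvd n"
    by (metis dvd_div_mult_self dvd_triv_left gcd_dvd2)
  have "u \<in> Upper (zn_order n) {a, b} \<longleftrightarrow> u \<in> zn_coset_one n ?c" for u
  proof -
    have "u \<in> Upper (zn_order n) {a, b} \<longleftrightarrow>
        u \<in> {0..n-1} \<and> a \<sqsubseteq>\<^bsub>zn_order n\<^esub> u \<and> b \<sqsubseteq>\<^bsub>zn_order n\<^esub> u"
      using assms(2,3) by (auto simp: Upper_def carr)
    \<comment> \<open>The equality case of the order drops out: if \<open>a = u\<close>, then
      \<open>b\<close> below \<open>u\<close> would make \<open>b\<close> below \<open>a\<close>,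
      against incomparability; the case \<open>b = u\<close> is symmetric.\<close>
    also have "\<dots> \<longleftrightarrow> u \<in> {0..n-1} \<and> n dvd a * (u - 1) \<and> n dvd b * (u - 1)"
      using assms(4,5) le by metis
    also have "\<dots> \<longleftrightarrow> u \<in> {0..n-1} \<and> ?c dvd u - 1"
      using assms(1) by (simp only: dvd_gcd_mult_iff)
    also have "\<dots> \<longleftrightarrow> u \<in> zn_coset_one n ?c"
      using mem_zn_coset_one_iff[OF assms(1) \<open>?c dvd n\<close>] by simp
    finally show ?thesis .
  qed
  then show ?thesis by blast
qed

theorem theorem3p1:
  fixes n a b d :: int
  assumes "n > 1"
    and "a \<in> carrier (zn_order n)" and "b \<in> carrier (zn_order n)"
    and "\<not> a \<sqsubseteq>\<^bsub>zn_order n\<^esub> b" and "\<not> b \<sqsubseteq>\<^bsub>zn_order n\<^esub> a"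
    and "d = gcd (gcd a b) n"
  shows "has_join (zn_order n) a b \<longleftrightarrow>
         (\<exists>m. least (zn_order n) m (zn_coset_one n (n div d)))"
  using Upper_zn_order_incomparable[OF assms(1-5)] assms(6)
  by (simp add: has_join_def)

end
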